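(* Let $\ell\ge3$. Suppose that $\lambda$ is an $(\ell,0)$-JM partition and $0\le i<\ell$. Write $\widehat\varphi=\widehat\varphi_i(\lambda)$ and $\widehat\varepsilon=\widehat\varepsilon_i(\lambda)$. Then 1. $\widehat f_i^{\,k}\lambda$ is not an $(\ell,0)$-JM partition for $0<k<\widehat\varphi-1$; 2. $\widehat e_i^{\,k}\lambda$ is not an $(\ell,0)$-JM partition for $1<k<\widehat\varepsilon$.
   Context: $h^\lambda_{(a,b)}$ is the hook length of the box in row $a$, column $b$: the number of boxes of $\lambda$ to the right of and below $(a,b)$ (same row or column), including $(a,b)$. A partition $\lambda$ is an $(\ell,0)$-JM partition if there do not exist boxes $(a,b),(a,y),(x,b)$ in its Young diagram with $\ell\mid h^\lambda_{(a,b)}$, $\ell\nmid h^\lambda_{(a,y)}$ and $\ell\nmid h^\lambda_{(x,b)}$. Ladder crystal operators. The position $(a,b)$ (row $a$, column $b$) has residue $b-a\bmod\ell$. The ladder of $(a,b)$ is the set of positions $(c,d)$, $c,d\ge1$, with $c-a=(\ell-1)(b-d)$; all its positions have the same residue, and it is an $i$-ladder if that residue is $i$. Ladders are ordered left to right, i.e. by increasing value of $a+(\ell-1)(b-1)$. A box of $\lambda$ of residue $i$ whose removal leaves a partition is a removable $i$-box; a position of residue $i$ not in $\lambda$ whose addition gives a partition is an addable $i$-box. Given a partition $\lambda$, label each addable $i$-box $+$ and each removable $i$-box $-$; the ladder $i$-signature is the word read from leftmost $i$-ladder to rightmost $i$-ladder, and from top to bottom on each ladder. Repeatedly cancel adjacent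 pairs $-+$ to get the reduced ladder $i$-signature $+\cdots+-\cdots-$. The number of remaining $+$'s is $\widehat\varphi_i(\lambda)$ and the number of remaining $-$'s is $\widehat\varepsilon_i(\lambda)$. $\widehat f_i\lambda$ is $\lambda$ together with the box of the rightmost remaining $+$ (or $0$ if there is none); $\widehat e_i\lambda$ is $\lambda$ with the box of the leftmost remaining $-$ removed (or $0$ if there is none). *)

theory Defs
  imports Main "HOL-Library.Product_Lexorder"
begin

text \<open>
  A position is a pair (row, column), both counted from 1, with row 1 at the top.
  A partition is identified with its Young diagram, a finite set of positions closed under
  going up and going left; \<open>young_diagram_iff\<close> below relates this to weakly decreasing lists
  of positive integers.
\<close>

type_synonym pos = "nat \<times> nat"

definition young_diagram :: "pos set \<Rightarrow> bool" where
  "young_diagram D \<longleftrightarrow> finite D \<and> (\<forall>(a, b) \<in> D. 1 \<le> a \<and> 1 \<le> b) \<and>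
     (\<forall>(a, b) \<in> D. \<forall>c d. 1 \<le> c \<and> c \<le> a \<and> 1 \<le> d \<and> d \<le> b \<longrightarrow> (c, d) \<in> D)"

definition diagram_of :: "nat list \<Rightarrow> pos set" where
  "diagram_of p = {(a, b). 1 \<le> a \<and> a \<le> length p \<and> 1 \<le> b \<and> b \<le> p ! (a - 1)}"

definition hook_length :: "pos set \<Rightarrow> pos \<Rightarrow> nat" where
  "hook_length D = (\<lambda>(a, b). card {(c, d) \<in> D. (c = a \<and> b \<le> d) \<or> (d = b \<and> a \<le> c)})"

text \<open>
  The condition defining \<open>(l,0)\<close>-JM partitions, to be used for Young diagrams \<open>D\<close>;
  by \<open>young_diagram_crystal_power\<close> below the crystal operators preserve \<open>young_diagram\<close>.
\<close>

definition JM_partition :: "nat \<Rightarrow> pos set \<Rightarrow> bool" where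
  "JM_partition l D \<longleftrightarrow>
     \<not> (\<exists>a b x y. (a, b) \<in> D \<and> (a, y) \<in> D \<and> (x, b) \<in> D \<and>
          l dvd hook_length D (a, b) \<and> \<not> l dvd hook_length D (a, y) \<and>
          \<not> l dvd hook_length D (x, b))"

definition residue :: "nat \<Rightarrow> pos \<Rightarrow> int" where
  "residue l = (\<lambda>(a, b). (int b - int a) mod int l)"

definition addable :: "nat \<Rightarrow> nat \<Rightarrow> pos set \<Rightarrow> pos set" where
  "addable l i D = {p. residue l p = int i \<and> p \<notin> D \<and> young_diagram (insert p D)}"

definition removable :: "nat \<Rightarrow> nat \<Rightarrow> pos set \<Rightarrow> pos set" where
  "removable l i D = {p. residue l p = int i \<and> p \<in> D \<and> young_diagram (D - {p})}"

definition ladder :: "nat \<Rightarrow> pos \<Rightarrow> pos set" where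
  "ladder l = (\<lambda>(a, b). {(c, d). 1 \<le> c \<and> 1 \<le> d \<and>
      int c - int a = (int l - 1) * (int b - int d)})"

text \<open>
  The number by which ladders are ordered from left to right; by \<open>same_ladder_iff\<close> below
  it is constant exactly on ladders.
\<close>

definition ladder_index :: "nat \<Rightarrow> pos \<Rightarrow> nat" where
  "ladder_index l = (\<lambda>(a, b). a + (l - 1) * (b - 1))"

datatype sign = Plus | Minus

type_synonym word = "(sign \<times> pos) list"

text \<open>
  Each letter of the signature remembers the position it comes from.  The letters are sorted
  lexicographically by ladder and then by row (the column is determined by these two).
\<close>

definition ladder_signature :: "nat \<Rightarrow> nat \<Rightarrow> pos set \<Rightarrow> word" where
  "ladder_signature l i D =
     map (\<lambda>(n, p). (if p \<in> addable l i D then Plus else Minus, p))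
       (sorted_list_of_set
         {(ladder_index l p, p) | p. p \<in> addable l i D \<union> removable l i D})"

inductive cancel_step :: "word \<Rightarrow> word \<Rightarrow> bool" where
  "cancel_step (xs @ (Minus, p) # (Plus, q) # ys) (xs @ ys)"

text \<open>
  The normal form with respect to \<open>cancel_step\<close>; see \<open>reduce_eq_iff\<close> below.
\<close>

fun reduce :: "word \<Rightarrow> word" where
  "reduce [] = []"
| "reduce (x # xs) =
     (case reduce xs of
        [] \<Rightarrow> [x]
      | y # ys \<Rightarrow> if fst x = Minus \<and> fst y = Plus then ys else x # y # ys)"

definition reduced_signature :: "nat \<Rightarrow> nat \<Rightarrow> pos set \<Rightarrow> word" where
  "reduced_signature l i D = reduce (ladder_signature l i D)"

definition remaining :: "sign \<Rightarrow> nat \<Rightarrow> nat \<Rightarrow> pos set \<Rightarrow> pos list" where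
  "remaining s l i D = map snd (filter (\<lambda>x. fst x = s) (reduced_signature l i D))"

definition phi_hat :: "nat \<Rightarrow> nat \<Rightarrow> pos set \<Rightarrow> nat" where
  "phi_hat l i D = length (remaining Plus l i D)"

definition eps_hat :: "nat \<Rightarrow> nat \<Rightarrow> pos set \<Rightarrow> nat" where
  "eps_hat l i D = length (remaining Minus l i D)"

text \<open>The value \<open>None\<close> stands for the 0 of the crystal.\<close>

definition f_hat :: "nat \<Rightarrow> nat \<Rightarrow> pos set \<Rightarrow> pos set option" where
  "f_hat l i D = (if remaining Plus l i D = [] then None
                  else Some (insert (last (remaining Plus l i D)) D))"

definition e_hat :: "nat \<Rightarrow> nat \<Rightarrow> pos set \<Rightarrow> pos set option" where
  "e_hat l i D = (if remaining Minus l i D = [] then None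
                  else Some (D - {hd (remaining Minus l i D)}))"

definition crystal_power :: "(pos set \<Rightarrow> pos set option) \<Rightarrow> nat \<Rightarrow> pos set \<Rightarrow> pos set option" where
  "crystal_power g k D = ((\<lambda>x. Option.bind x g) ^^ k) (Some D)"


lemma young_diagram_diagram_of:
  assumes "sorted_wrt (\<ge>) p"
  shows "young_diagram (diagram_of p)"
proof -
  have mono: "p ! (a - 1) \<le> p ! (c - 1)" if "1 \<le> c" "c \<le> a" "a \<le> length p" for a c
  proof (cases "c = a")
    case False
    with that have "c - 1 < a - 1" "a - 1 < length p" by linarith+
    then show ?thesis by (rule sorted_wrt_nth_less[OF assms])
  qed simp
  have "diagram_of p \<subseteq> {..length p} \<times> {..Max (set p)}"
  proof clarify
    fix a b assume ab: "(a, b) \<in> diagram_of p"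
    then have "p ! (a - 1) \<in> set p" by (intro nth_mem) (auto simp: diagram_of_def)
    then have "p ! (a - 1) \<le> Max (set p)" by (rule Max_ge[OF finite_set])
    with ab show "a \<in> {..length p} \<and> b \<in> {..Max (set p)}" by (auto simp: diagram_of_def)
  qed
  then have "finite (diagram_of p)" by (rule finite_subset) auto
  moreover have "(c, d) \<in> diagram_of p"
    if "(a, b) \<in> diagram_of p" "1 \<le> c" "c \<le> a" "1 \<le> d" "d \<le> b" for a b c d
  proof -
    have ab: "a \<le> length p" "b \<le> p ! (a - 1)" using that(1) by (simp_all add: diagram_of_def)
    have "p ! (a - 1) \<le> p ! (c - 1)" by (rule mono[OF that(2,3) ab(1)])
    then show ?thesis using that(2-5) ab unfolding diagram_of_def by simp
  qed
  moreover have "1 \<le> a \<and> 1 \<le> b" if "(a, b) \<in> diagram_of p" for a b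
    using that by (auto simp: diagram_of_def)
  ultimately show ?thesis unfolding young_diagram_def by blast
qed

lemma initial_segment_eq:
  fixes S :: "nat set"
  assumes "finite S" "\<And>x. x \<in> S \<Longrightarrow> 1 \<le> x" "\<And>x y. x \<in> S \<Longrightarrow> 1 \<le> y \<Longrightarrow> y \<le> x \<Longrightarrow> y \<in> S"
  shows "S = {1..card S}"
proof (cases "S = {}")
  case False
  have "S = {1..Max S}"
  proof (intro set_eqI iffI)
    fix x assume x: "x \<in> S"
    then show "x \<in> {1..Max S}" using assms(2)[OF x] Max_ge[OF assms(1) x] by simp
  next
    fix x assume "x \<in> {1..Max S}"
    then show "x \<in> S" using assms(3)[OF Max_in[OF assms(1) False]] by simp
  qed
  then have "S = {1..Max S}" "card S = Max S" by (auto dest: arg_cong[of _ _ card])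
  then show ?thesis by simp
qed simp

lemma young_diagram_iff:
  "young_diagram D \<longleftrightarrow> (\<exists>p. sorted_wrt (\<ge>) p \<and> 0 \<notin> set p \<and> D = diagram_of p)"
proof
  assume D: "young_diagram D"
  define R where "R a = {b. (a, b) \<in> D}" for a
  define C where "C = {a. (a, 1) \<in> D}"
  have fin: "finite D" using D by (simp add: young_diagram_def)
  have pos: "1 \<le> a" "1 \<le> b" if "(a, b) \<in> D" for a b
    using D that by (auto simp: young_diagram_def)
  have down: "(c, d) \<in> D" if "(a, b) \<in> D" "1 \<le> c" "c \<le> a" "1 \<le> d" "d \<le> b" for a b c d
    using D that unfolding young_diagram_def by blast
  have finR: "finite (R a)" for a
    by (rule finite_subset[of _ "snd ` D"]) (use fin in \<open>force simp: R_def\<close>)+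
  have finC: "finite C"
    by (rule finite_subset[of _ "fst ` D"]) (use fin in \<open>force simp: C_def\<close>)+
  have inR: "b \<in> R a \<longleftrightarrow> 1 \<le> b \<and> b \<le> card (R a)" for a b
  proof -
    have "R a = {1..card (R a)}"
    proof (rule initial_segment_eq[OF finR])
      fix x assume "x \<in> R a"
      then have x: "(a, x) \<in> D" by (simp add: R_def)
      from pos(2)[OF x] show "1 \<le> x" .
      fix y assume "1 \<le> y" "y \<le> x"
      from down[OF x pos(1)[OF x] order_refl this] show "y \<in> R a" by (simp add: R_def)
    qed
    then show ?thesis by (metis atLeastAtMost_iff)
  qed
  have inC: "a \<in> C \<longleftrightarrow> 1 \<le> a \<and> a \<le> card C" for a
  proof -
    have "C = {1..card C}"
    proof (rule initial_segment_eq[OF finC])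
      fix x assume "x \<in> C"
      then have x: "(x, 1) \<in> D" by (simp add: C_def)
      from pos(1)[OF x] show "1 \<le> x" .
      fix y assume "1 \<le> y" "y \<le> x"
      from down[OF x this order_refl order_refl] show "y \<in> C" by (simp add: C_def)
    qed
    then show ?thesis by (metis atLeastAtMost_iff)
  qed
  define p where "p = map (\<lambda>a. card (R (Suc a))) [0..<card C]"
  have len: "length p = card C" by (simp add: p_def)
  have nth: "p ! (a - 1) = card (R a)" if "1 \<le> a" "a \<le> card C" for a
    using that by (cases a) (simp_all add: p_def del: upt_Suc)
  have "(a, b) \<in> D \<longleftrightarrow> (a, b) \<in> diagram_of p" for a b
  proof -
    have "(a, b) \<in> D \<longleftrightarrow> a \<in> C \<and> b \<in> R a"
    proof
      assume x: "(a, b) \<in> D"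
      from down[OF x pos(1)[OF x] order_refl order_refl pos(2)[OF x]] x
      show "a \<in> C \<and> b \<in> R a" by (simp add: R_def C_def)
    qed (simp add: R_def)
    also have "\<dots> \<longleftrightarrow> (1 \<le> a \<and> a \<le> card C) \<and> (1 \<le> b \<and> b \<le> card (R a))"
      by (simp only: inC inR)
    also have "\<dots> \<longleftrightarrow> (a, b) \<in> diagram_of p"
      using nth by (auto simp: diagram_of_def len)
    finally show ?thesis .
  qed
  then have "D = diagram_of p" by auto
  moreover have "sorted_wrt (\<ge>) p"
    unfolding p_def sorted_wrt_map
  proof (rule sorted_wrt_mono_rel[OF _ sorted_wrt_upt])
    fix a c :: nat assume "a < c"
    then show "card (R (Suc c)) \<le> card (R (Suc a))"
    proof (intro card_mono finR subsetI)
      fix b assume "b \<in> R (Suc c)"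
      then have x: "(Suc c, b) \<in> D" by (simp add: R_def)
      from down[OF x _ _ pos(2)[OF x] order_refl, of "Suc a"] \<open>a < c\<close>
      show "b \<in> R (Suc a)" by (simp add: R_def)
    qed
  qed
  moreover have "0 \<notin> set p"
  proof
    assume "0 \<in> set p"
    then obtain a where a: "a < card C" "card (R (Suc a)) = 0" by (auto simp: p_def)
    then have "Suc a \<in> C" by (simp add: inC)
    then have "1 \<in> R (Suc a)" by (simp add: C_def R_def)
    with a inR[of 1 "Suc a"] show False by simp
  qed
  ultimately show "\<exists>p. sorted_wrt (\<ge>) p \<and> 0 \<notin> set p \<and> D = diagram_of p" by blast
qed (auto intro: young_diagram_diagram_of)

lemma same_ladder_iff:
  assumes "2 \<le> l" "1 \<le> a" "1 \<le> b" "1 \<le> c" "1 \<le> d"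
  shows "(c, d) \<in> ladder l (a, b) \<longleftrightarrow> ladder_index l (c, d) = ladder_index l (a, b)"
proof -
  have idx: "int (ladder_index l (x, y)) = int x + (int l - 1) * (int y - 1)" if "1 \<le> y" for x y
    using assms(1) that by (simp add: ladder_index_def of_nat_diff)
  have "ladder_index l (c, d) = ladder_index l (a, b) \<longleftrightarrow>
        int (ladder_index l (c, d)) = int (ladder_index l (a, b))" by linarith
  also have "\<dots> \<longleftrightarrow> int c - int a = (int l - 1) * (int b - int d)"
    unfolding idx[OF assms(3)] idx[OF assms(5)] by (auto simp: algebra_simps)
  finally show ?thesis using assms by (simp add: ladder_def)
qed

lemma finite_addable:
  assumes "young_diagram D"
  shows "finite (addable l i D)"
proof -
  have D: "finite D" using assms by (simp add: young_diagram_def)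
  define N where "N = Suc (Max (insert 0 (fst ` D \<union> snd ` D)))"
  have N: "a < N \<and> b < N" if "(a, b) \<in> D" for a b
  proof -
    have fin: "finite (insert 0 (fst ` D \<union> snd ` D))" using D by simp
    have "a \<in> insert 0 (fst ` D \<union> snd ` D)" "b \<in> insert 0 (fst ` D \<union> snd ` D)"
      using that by force+
    from Max_ge[OF fin this(1)] Max_ge[OF fin this(2)] show ?thesis
      unfolding N_def by linarith
  qed
  have "addable l i D \<subseteq> {..Suc N} \<times> {..Suc N}"
  proof clarify
    fix a b assume "(a, b) \<in> addable l i D"
    then have Y: "young_diagram (insert (a, b) D)" by (simp add: addable_def)
    then have ab: "1 \<le> a" "1 \<le> b" by (auto simp: young_diagram_def)
    have down: "(c, d) \<in> insert (a, b) D" if "1 \<le> c" "c \<le> a" "1 \<le> d" "d \<le> b" for c d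
      using Y that unfolding young_diagram_def by blast
    have "a \<le> Suc N"
    proof (cases "a = 1")
      case False
      then have "(a - 1, b) \<in> D" using down[of "a - 1" b] ab by fastforce
      then have "a - 1 < N" using N by blast
      then show ?thesis by linarith
    qed simp
    moreover have "b \<le> Suc N"
    proof (cases "b = 1")
      case False
      then have "(a, b - 1) \<in> D" using down[of a "b - 1"] ab by fastforce
      then have "b - 1 < N" using N by blast
      then show ?thesis by linarith
    qed simp
    ultimately show "a \<in> {..Suc N} \<and> b \<in> {..Suc N}" by simp
  qed
  then show ?thesis by (rule finite_subset) auto
qed

lemma ladder_signature_props:
  assumes "young_diagram D"
  shows "set (map snd (ladder_signature l i D)) = addable l i D \<union> removable l i D"
    and "distinct (map snd (ladder_signature l i D))"
    and "sorted (map (\<lambda>x. (ladder_index l (snd x), fst (snd x))) (ladder_signature l i D))"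
proof -
  let ?S = "addable l i D \<union> removable l i D"
  let ?g = "\<lambda>p. (ladder_index l p, p)"
  have "removable l i D \<subseteq> D" by (auto simp: removable_def)
  then have "finite ?S"
    using finite_addable[OF assms(1)] assms(1) by (auto simp: young_diagram_def intro: finite_subset)
  then have fin: "finite (?g ` ?S)" by (rule finite_imageI)
  have eq: "{(ladder_index l p, p) | p. p \<in> ?S} = ?g ` ?S" by blast
  define xs where "xs = sorted_list_of_set (?g ` ?S)"
  have xs: "set xs = ?g ` ?S" "sorted xs" "distinct xs"
    using fin by (simp_all add: xs_def)
  have sig: "ladder_signature l i D =
      map (\<lambda>(n, p). (if p \<in> addable l i D then Plus else Minus, p)) xs"
    unfolding ladder_signature_def eq xs_def ..
  have snd: "map snd (ladder_signature l i D) = map snd xs"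
    by (simp add: sig case_prod_beta)
  have "set (map snd xs) = snd ` set xs" by simp
  also have "\<dots> = ?S" unfolding xs(1) by (simp add: image_image)
  finally show "set (map snd (ladder_signature l i D)) = ?S" unfolding snd .
  have "inj_on snd (set xs)" unfolding xs(1) by (auto simp: inj_on_def)
  then show "distinct (map snd (ladder_signature l i D))"
    unfolding snd using xs(3) by (simp add: distinct_map)
  have "map (\<lambda>x. (ladder_index l (snd x), fst (snd x))) (ladder_signature l i D) =
      map (\<lambda>p. (ladder_index l p, fst p)) (map snd (ladder_signature l i D))"
    by simp
  also have "\<dots> = map (\<lambda>(n, p). (n, fst p)) xs"
    unfolding snd using xs(1) by auto
  finally have "map (\<lambda>x. (ladder_index l (snd x), fst (snd x))) (ladder_signature l i D) =
      map (\<lambda>(n, p). (n, fst p)) xs" .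
  moreover have "sorted (map (\<lambda>(n, p). (n, fst p)) xs)"
    unfolding sorted_map
  proof (rule sorted_wrt_mono_rel[OF _ xs(2)])
    fix x y :: "nat \<times> pos" assume "x \<le> y"
    then show "(case x of (n, p) \<Rightarrow> (n, fst p)) \<le> (case y of (n, p) \<Rightarrow> (n, fst p))"
      by (cases x, cases y) (auto simp: less_eq_prod_def less_prod_def)
  qed
  ultimately show "sorted (map (\<lambda>x. (ladder_index l (snd x), fst (snd x))) (ladder_signature l i D))"
    by simp
qed

lemma reduce_cancel_step: "cancel_step w w' \<Longrightarrow> reduce w = reduce w'"
proof (induction rule: cancel_step.induct)
  case (1 xs p q ys)
  show ?case by (induction xs) (auto split: list.splits)
qed

lemma cancel_step_Cons: "cancel_step w w' \<Longrightarrow> cancel_step (x # w) (x # w')"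
  by (metis append_Cons cancel_step.simps)

lemma cancel_steps_reduce: "cancel_step\<^sup>*\<^sup>* w (reduce w)"
proof (induction w)
  case (Cons x w)
  have "cancel_step\<^sup>*\<^sup>* (x # w) (x # reduce w)"
    using Cons by (induction rule: rtranclp_induct)
      (auto intro: rtranclp.rtrancl_into_rtrancl cancel_step_Cons)
  moreover have "cancel_step\<^sup>*\<^sup>* (x # reduce w) (reduce (x # w))"
  proof (cases "reduce w")
    case (Cons y ys)
    show ?thesis
    proof (cases "fst x = Minus \<and> fst y = Plus")
      case True
      then have "cancel_step (x # y # ys) ys"
        using cancel_step.intros[of "[]" "snd x" "snd y" ys] by (cases x, cases y) auto
      with True Cons show ?thesis by auto
    qed (use Cons in auto)
  qed simp
  ultimately show ?case by (rule rtranclp_trans)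
qed simp

lemma reduce_irreducible: "\<not> cancel_step (reduce w) w'"
proof (induction w arbitrary: w')
  case Nil
  show ?case by (auto elim: cancel_step.cases)
next
  case (Cons x w)
  show ?case
  proof
    assume "cancel_step (reduce (x # w)) w'"
    then obtain xs p q ys where e: "reduce (x # w) = xs @ (Minus, p) # (Plus, q) # ys"
      by (auto elim: cancel_step.cases)
    have "\<exists>us. reduce w = us @ (Minus, p) # (Plus, q) # ys"
    proof (cases "reduce w")
      case Nil
      with e show ?thesis by (cases xs) auto
    next
      case C: (Cons y zs)
      show ?thesis
      proof (cases "fst x = Minus \<and> fst y = Plus")
        case True
        with e C have "reduce w = (y # xs) @ (Minus, p) # (Plus, q) # ys" by simp
        then show ?thesis by blast
      next
        case False
        with e C have "x # reduce w = xs @ (Minus, p) # (Plus, q) # ys" by simp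
        with False C show ?thesis by (cases xs) auto
      qed
    qed
    with Cons show False by (metis cancel_step.intros)
  qed
qed

lemma reduce_eq_iff:
  "reduce w = v \<longleftrightarrow> cancel_step\<^sup>*\<^sup>* w v \<and> (\<nexists>v'. cancel_step v v')"
proof
  assume v: "cancel_step\<^sup>*\<^sup>* w v \<and> (\<nexists>v'. cancel_step v v')"
  then have "cancel_step\<^sup>*\<^sup>* w v" ..
  then have "reduce w = reduce v"
    by (induction rule: rtranclp_induct) (auto simp: reduce_cancel_step)
  moreover have "reduce v = v"
    using cancel_steps_reduce[of v] v by (auto elim: converse_rtranclpE)
  ultimately show "reduce w = v" by simp
qed (use cancel_steps_reduce reduce_irreducible in blast)

lemma set_reduce: "set (reduce w) \<subseteq> set w"
  by (induction w) (auto split: list.splits if_splits)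

lemma set_remaining:
  assumes "young_diagram D"
  shows "set (remaining Plus l i D) \<subseteq> addable l i D"
    and "set (remaining Minus l i D) \<subseteq> removable l i D"
proof -
  have sgn: "fst x = (if snd x \<in> addable l i D then Plus else Minus)"
    and pos: "snd x \<in> addable l i D \<union> removable l i D"
    if "x \<in> set (ladder_signature l i D)" for x
  proof -
    show "fst x = (if snd x \<in> addable l i D then Plus else Minus)"
      using that unfolding ladder_signature_def set_map by (elim imageE) (simp add: case_prod_beta)
    show "snd x \<in> addable l i D \<union> removable l i D"
      using that ladder_signature_props(1)[OF assms, of l i] by (metis image_eqI set_map)
  qed
  have rem: "\<exists>x \<in> set (ladder_signature l i D). fst x = t \<and> snd x = p"
    if "p \<in> set (remaining t l i D)" for p t
    using that set_reduce unfolding remaining_def reduced_signature_def by fastforce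
  show "set (remaining Plus l i D) \<subseteq> addable l i D"
    using rem sgn by (metis sign.distinct(1) subsetI)
  show "set (remaining Minus l i D) \<subseteq> removable l i D"
    using rem sgn pos by (metis UnE sign.distinct(1) subsetI)
qed

lemma young_diagram_f_hat:
  assumes "young_diagram D" "f_hat l i D = Some E"
  shows "young_diagram E"
proof -
  have ne: "remaining Plus l i D \<noteq> []" using assms(2) by (auto simp: f_hat_def)
  then have "last (remaining Plus l i D) \<in> addable l i D"
    using set_remaining(1)[OF assms(1)] last_in_set by blast
  with ne assms(2) show ?thesis by (auto simp: f_hat_def addable_def)
qed

lemma young_diagram_e_hat:
  assumes "young_diagram D" "e_hat l i D = Some E"
  shows "young_diagram E"
proof -
  have ne: "remaining Minus l i D \<noteq> []" using assms(2) by (auto simp: e_hat_def)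
  then have "hd (remaining Minus l i D) \<in> removable l i D"
    using set_remaining(2)[OF assms(1)] hd_in_set by blast
  with ne assms(2) show ?thesis by (auto simp: e_hat_def removable_def)
qed

lemma young_diagram_crystal_power:
  assumes "\<And>D E. young_diagram D \<Longrightarrow> g D = Some E \<Longrightarrow> young_diagram E"
    and "young_diagram D" "crystal_power g k D = Some E"
  shows "young_diagram E"
  using assms(3) unfolding crystal_power_def
proof (induction k arbitrary: E)
  case (Suc k)
  then obtain F where "((\<lambda>x. Option.bind x g) ^^ k) (Some D) = Some F" "g F = Some E"
    by (auto simp: bind_eq_Some_conv)
  with Suc.IH assms(1) show ?case by blast
qed (use assms(2) in simp)

end

theory Submission
  imports Defs
begin

text \<open>
  A removable \<open>i\<close>-box and an addable \<open>i\<close>-box span a hook (row of the upper one, column of the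
  lower one) of length divisible by \<open>l\<close>; two addable \<open>i\<close>-boxes span a hook of length
  congruent to \<open>-1\<close>, and the hook of a removable box is \<open>1\<close>.  Hence a removable \<open>i\<close>-box together
  with two addable \<open>i\<close>-boxes violates the JM condition.  Each crystal operator only changes the
  sign of one letter of the reduced signature, so all partitions strictly inside the ranges of
  the theorem have at least one removable and at least two addable \<open>i\<close>-boxes.
\<close>

section \<open>Local criteria for addable and removable boxes\<close>

lemma young_diagram_down:
  assumes "young_diagram D" "(a, b) \<in> D" "1 \<le> c" "c \<le> a" "1 \<le> d" "d \<le> b"
  shows "(c, d) \<in> D"
  using assms unfolding young_diagram_def by blast

lemma young_diagram_ge_1:
  assumes "young_diagram D" "(a, b) \<in> D"
  shows "1 \<le> a" "1 \<le> b"
  using assms unfolding young_diagram_def by auto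

lemma young_diagram_insert_iff:
  assumes "young_diagram D" "(a, b) \<notin> D"
  shows "young_diagram (insert (a, b) D) \<longleftrightarrow>
    1 \<le> a \<and> 1 \<le> b \<and> (a = 1 \<or> (a - 1, b) \<in> D) \<and> (b = 1 \<or> (a, b - 1) \<in> D)"
proof
  assume Y: "young_diagram (insert (a, b) D)"
  have ab: "1 \<le> a" "1 \<le> b" using young_diagram_ge_1[OF Y, of a b] by auto
  have "(a - 1, b) \<in> insert (a, b) D" if "a \<noteq> 1"
    by (rule young_diagram_down[OF Y, of a b]) (use ab that in auto)
  moreover have "(a, b - 1) \<in> insert (a, b) D" if "b \<noteq> 1"
    by (rule young_diagram_down[OF Y, of a b]) (use ab that in auto)
  ultimately show "1 \<le> a \<and> 1 \<le> b \<and> (a = 1 \<or> (a - 1, b) \<in> D) \<and> (b = 1 \<or> (a, b - 1) \<in> D)"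
    using ab by fastforce
next
  assume *: "1 \<le> a \<and> 1 \<le> b \<and> (a = 1 \<or> (a - 1, b) \<in> D) \<and> (b = 1 \<or> (a, b - 1) \<in> D)"
  have "(c, d) \<in> insert (a, b) D" if "1 \<le> c" "c \<le> a" "1 \<le> d" "d \<le> b" for c d
  proof (cases "c = a")
    case True
    then show ?thesis
      using that * young_diagram_down[OF assms(1), of a "b - 1" c d] by (cases "d = b") auto
  next
    case False
    then show ?thesis
      using that * young_diagram_down[OF assms(1), of "a - 1" b c d] by auto
  qed
  then show "young_diagram (insert (a, b) D)"
    using * assms(1) unfolding young_diagram_def by auto
qed

lemma young_diagram_remove_iff:
  assumes "young_diagram D" "(a, b) \<in> D"
  shows "young_diagram (D - {(a, b)}) \<longleftrightarrow> (Suc a, b) \<notin> D \<and> (a, Suc b) \<notin> D"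
proof
  assume Y: "young_diagram (D - {(a, b)})"
  show "(Suc a, b) \<notin> D \<and> (a, Suc b) \<notin> D"
    using young_diagram_ge_1[OF assms] young_diagram_down[OF Y, of "Suc a" b a b]
      young_diagram_down[OF Y, of a "Suc b" a b] by auto
next
  assume *: "(Suc a, b) \<notin> D \<and> (a, Suc b) \<notin> D"
  \<comment> \<open>Deleting \<open>(a, b)\<close> can only break closure for boxes weakly below and
    to the right of it. Any such box other than \<open>(a, b)\<close> would force the lower or the
    right neighbour of \<open>(a, b)\<close> into \<open>D\<close>.\<close>
  have "(x, y) \<notin> D" if "(x, y) \<noteq> (a, b)" "a \<le> x" "b \<le> y" for x y
    using * that young_diagram_ge_1[OF assms] young_diagram_down[OF assms(1), of x y "Suc a" b]
      young_diagram_down[OF assms(1), of x y a "Suc b"]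
    by (cases "x = a") auto
  then show "young_diagram (D - {(a, b)})"
    using assms(1) unfolding young_diagram_def by (clarsimp simp: Ball_def) blast
qed

lemma addable_iff:
  assumes "young_diagram D"
  shows "(a, b) \<in> addable l i D \<longleftrightarrow> residue l (a, b) = int i \<and> (a, b) \<notin> D \<and>
    1 \<le> a \<and> 1 \<le> b \<and> (a = 1 \<or> (a - 1, b) \<in> D) \<and> (b = 1 \<or> (a, b - 1) \<in> D)"
  using young_diagram_insert_iff[OF assms, of a b] by (auto simp: addable_def)

lemma removable_iff:
  assumes "young_diagram D"
  shows "(a, b) \<in> removable l i D \<longleftrightarrow> residue l (a, b) = int i \<and> (a, b) \<in> D \<and>
    (Suc a, b) \<notin> D \<and> (a, Suc b) \<notin> D"
  using young_diagram_remove_iff[OF assms, of a b] by (auto simp: removable_def)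

section \<open>Hook lengths modulo \<open>l\<close> and the JM condition\<close>

lemma same_residue_dvd:
  assumes "residue l (a, b) = residue l (c, d)"
  shows "int l dvd (int b - int a) - (int d - int c)"
  using assms by (simp add: residue_def mod_eq_dvd_iff)

lemma not_dvd_1:
  assumes "2 \<le> l"
  shows "\<not> int l dvd 1" "\<not> int l dvd - 1"
  using assms by auto

text \<open>Here \<open>y\<close> is the end of row \<open>a\<close> and \<open>x\<close> is the end
  of column \<open>b\<close>, so the terms are arm, leg and corner. The bounds
  \<open>a \<le> x\<close> and \<open>b \<le> y\<close> make the truncated subtractions exact, which
  later allows the hook length to be rewritten over the integers as a difference of contents (column
  minus row).\<close>

lemma hook_length_eq:
  assumes D: "young_diagram D" and "(a, y) \<in> D" "(a, Suc y) \<notin> D"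
    and "(x, b) \<in> D" "(Suc x, b) \<notin> D" and "a \<le> x" "b \<le> y"
  shows "hook_length D (a, b) = (y - b) + (x - a) + 1"
proof -
  note ge = young_diagram_ge_1[OF D]
  have ab: "1 \<le> a" "1 \<le> b" using ge assms by blast+
  have row: "(a, d) \<in> D \<longleftrightarrow> d \<le> y" if "b \<le> d" for d
  proof
    show "d \<le> y" if "(a, d) \<in> D"
      using young_diagram_down[OF D that, of a "Suc y"] ab assms(3) by force
    show "(a, d) \<in> D" if "d \<le> y"
      using young_diagram_down[OF D assms(2), of a d] ab that \<open>b \<le> d\<close> by simp
  qed
  have col: "(c, b) \<in> D \<longleftrightarrow> c \<le> x" if "a \<le> c" for c
  proof
    show "c \<le> x" if "(c, b) \<in> D"
      using young_diagram_down[OF D that, of "Suc x" b] ab assms(5) by force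
    show "(c, b) \<in> D" if "c \<le> x"
      using young_diagram_down[OF D assms(4), of c b] ab that \<open>a \<le> c\<close> by simp
  qed
  \<comment> \<open>The corner is counted with the row, hence the column part starts at
    \<open>Suc a\<close>.\<close>
  have "{(c, d) \<in> D. (c = a \<and> b \<le> d) \<or> (d = b \<and> a \<le> c)} = {a} \<times> {b..y} \<union> {Suc a..x} \<times> {b}"
  proof (intro set_eqI, clarify)
    fix c d
    consider "c = a" | "c \<noteq> a" "d = b" | "c \<noteq> a" "d \<noteq> b" by blast
    then show "(c, d) \<in> {(c, d) \<in> D. (c = a \<and> b \<le> d) \<or> (d = b \<and> a \<le> c)} \<longleftrightarrow>
        (c, d) \<in> {a} \<times> {b..y} \<union> {Suc a..x} \<times> {b}"
    proof cases
      case 1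
      then show ?thesis using row[of d] by auto
    next
      case 2
      then show ?thesis using col[of c] by auto
    next
      case 3
      then show ?thesis by auto
    qed
  qed
  moreover have "card ({a} \<times> {b..y} \<union> {Suc a..x} \<times> {b}) = card ({a} \<times> {b..y}) + card ({Suc a..x} \<times> {b})"
    by (rule card_Un_disjoint) auto
  ultimately show ?thesis using assms(6,7) by (simp add: hook_length_def card_cartesian_product)
qed

text \<open>In either case the column is that of the first cell of row \<open>a\<close> outside
  \<open>D\<close>, whatever the residues are.\<close>

lemma addable_same_row:
  assumes D: "young_diagram D" and "(a, b) \<in> addable l i D" "(a, d) \<in> addable l j D"
  shows "b = d"
proof -
  have "y \<le> x" if "(a, x) \<in> addable l k D" "(a, y) \<in> addable l m D" for x y k m
  proof (rule ccontr)
    assume "\<not> y \<le> x"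
    with that have "(a, y - 1) \<in> D" "1 \<le> a" "1 \<le> x" "x \<le> y - 1" "(a, x) \<notin> D"
      unfolding addable_iff[OF D] by auto
    then show False using young_diagram_down[OF D, of a "y - 1" a x] by simp
  qed
  with assms(2,3) show ?thesis by (metis order_antisym)
qed

text \<open>The box \<open>(a1, d2)\<close>, spanned by the two addable positions, has hook length
  congruent to -1, and the removable box has hook length 1. The third corner lies in the row of one
  of these boxes and in the column of the other. It is spanned by the removable box and one addable
  position, so its hook length is divisible by \<open>l\<close>. Which addable position serves
  depends on whether \<open>c\<close> lies below or above row \<open>a1\<close>.\<close>

lemma JM_partition_addable_unique_aux:
  assumes l: "2 \<le> l" and D: "young_diagram D" and JM: "JM_partition l D"
    and R: "(c, b) \<in> removable l i D"
    and U1: "(a1, d1) \<in> addable l i D" and U2: "(a2, d2) \<in> addable l i D"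
    and less: "a1 < a2"
  shows False
proof -
  note ge = young_diagram_ge_1[OF D] and down = young_diagram_down[OF D]
  note r = R[unfolded removable_iff[OF D]] and u1 = U1[unfolded addable_iff[OF D]]
    and u2 = U2[unfolded addable_iff[OF D]]
  have cb: "1 \<le> c" "1 \<le> b" using ge r by blast+
  have u2': "(a2 - 1, d2) \<in> D" using u2 less u1 by auto
  have dd: "d2 < d1"
    using down[OF u2', of a1 d1] u1 less by force
  have u1': "(a1, d1 - 1) \<in> D" using u1 dd u2 by auto
  have "\<not> int l dvd int 1" using not_dvd_1[OF l] by simp
  moreover have "hook_length D (c, b) = 1"
    using hook_length_eq[OF D, of c b c b] r by simp
  ultimately have hR: "\<not> l dvd hook_length D (c, b)" by (simp only: int_dvd_int_iff not_False_eq_True)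
  have UU: "hook_length D (a1, d2) = (d1 - 1 - d2) + (a2 - 1 - a1) + 1"
    using hook_length_eq[OF D, of a1 "d1 - 1" "a2 - 1" d2] u1 u1' u2 u2' dd less by simp
  then have "int (hook_length D (a1, d2)) = ((int d1 - int a1) - (int d2 - int a2)) - 1"
    using dd less by simp
  then have hU: "\<not> l dvd hook_length D (a1, d2)"
    using same_residue_dvd[of l a1 d1 a2 d2] u1 u2 not_dvd_1[OF l]
    by (metis dvd_diff_right_iff int_dvd_int_iff)
  \<comment> \<open>In a common row the addable position would be the right neighbour of the
    removable box, and adjacent positions have different residues.\<close>
  have "a1 \<noteq> c"
  proof
    assume eq: "a1 = c"
    have "d1 = Suc b"
      using eq u1 r u1' down[of c "d1 - 1" c "Suc b"] down[of c b c d1] by (cases "d1 \<le> b") force+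
    with eq have "int l dvd 1" using same_residue_dvd[of l a1 d1 c b] u1 r by simp
    then show False using not_dvd_1[OF l] by simp
  qed
  then consider "a1 < c" | "c < a1" by linarith
  then show False
  proof cases
    \<comment> \<open>The violating corner is \<open>(a1, b)\<close>: its row ends just before the
      upper addable position and its column ends at the removable box.\<close>
    case 1
    have bd: "b < d1" using down[of c b a1 d1] u1 r 1 by (cases "b < d1") auto
    have "hook_length D (a1, b) = (d1 - 1 - b) + (c - a1) + 1"
      using hook_length_eq[OF D, of a1 "d1 - 1" c b] u1 u1' r 1 bd by simp
    then have "int (hook_length D (a1, b)) = (int d1 - int a1) - (int b - int c)"
      using 1 bd by simp
    then have "l dvd hook_length D (a1, b)"
      using same_residue_dvd[of l a1 d1 c b] u1 r by (metis int_dvd_int_iff)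
    moreover have "(a1, b) \<in> D" "(a1, d2) \<in> D"
      using down[OF u1', of a1] u1 u2 cb bd dd by auto
    ultimately show False using JM hR hU r unfolding JM_partition_def by blast
  next
    case 2
    \<comment> \<open>The box \<open>(a2 - 1, d2)\<close> lies strictly below row \<open>c\<close>.
      If \<open>b \<le> d2\<close>, it would force a right or lower neighbour of the removable box
      into \<open>D\<close>. With \<open>d2 < b\<close> the violating corner is
      \<open>(c, d2)\<close>.\<close>
    have "b < d2 \<Longrightarrow> (c, Suc b) \<in> D" "b = d2 \<Longrightarrow> (Suc c, b) \<in> D"
      using down[OF u2', of c "Suc b"] down[OF u2', of "Suc c" b] cb 2 less by auto
    then have bd: "d2 < b" using r by (meson linorder_neqE_nat)
    have "hook_length D (c, d2) = (b - d2) + (a2 - 1 - c) + 1"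
      using hook_length_eq[OF D, of c b "a2 - 1" d2] u2 u2' r 2 less bd by simp
    then have "int (hook_length D (c, d2)) = (int b - int c) - (int d2 - int a2)"
      using 2 bd less by simp
    then have "l dvd hook_length D (c, d2)"
      using same_residue_dvd[of l c b a2 d2] u2 r by (metis int_dvd_int_iff)
    moreover have "(c, d2) \<in> D" "(a1, d2) \<in> D"
      using down[OF u2', of c d2] down[OF u2', of a1 d2] u1 u2 cb 2 less by auto
    ultimately show False using JM hR hU r unfolding JM_partition_def by blast
  qed
qed

text \<open>Distinct addable positions lie in distinct rows, so they can be ordered by row as the
  auxiliary lemma requires.\<close>

lemma JM_partition_addable_unique:
  assumes "2 \<le> l" and D: "young_diagram D" and "JM_partition l D"
    and "p \<in> removable l i D" and q: "q1 \<in> addable l i D" "q2 \<in> addable l i D"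
  shows "q1 = q2"
proof -
  obtain c b a1 d1 a2 d2 where eq: "p = (c, b)" "q1 = (a1, d1)" "q2 = (a2, d2)"
    by (cases p, cases q1, cases q2)
  have "a1 = a2"
    using JM_partition_addable_unique_aux[OF assms(1-3)] assms(4) q
    unfolding eq by (meson linorder_neqE_nat)
  then show ?thesis using addable_same_row[OF D] q unfolding eq by blast
qed

subsection \<open>The effect of adding a box on the signature\<close>

text \<open>Adjacent contents differ by 1, which is nonzero modulo \<open>l\<close>. This keeps a
  change at one \<open>i\<close>-box from affecting other \<open>i\<close>-boxes.\<close>

lemma residue_neighbour:
  assumes "2 \<le> l"
  shows "residue l (Suc a, b) \<noteq> residue l (a, b)" "residue l (a, Suc b) \<noteq> residue l (a, b)"
  using same_residue_dvd[of l "Suc a" b a b] same_residue_dvd[of l a "Suc b" a b] not_dvd_1[OF assms]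
  by auto

text \<open>The status of a position depends only on itself and its four neighbours, and the
  neighbours of an \<open>i\<close>-box have residues other than \<open>i\<close>. So only the
  status of \<open>p\<close> changes.\<close>

lemma addable_removable_insert:
  assumes l: "2 \<le> l" and D: "young_diagram D" and p: "p \<in> addable l i D"
  shows "addable l i (insert p D) = addable l i D - {p}"
    and "removable l i (insert p D) = insert p (removable l i D)"
proof -
  obtain a b where ab: "p = (a, b)" by (cases p)
  have E: "young_diagram (insert p D)" and pD: "p \<notin> D" and rp: "residue l p = int i"
    using p by (auto simp: addable_def)
  note n = residue_neighbour[OF l]
  show "addable l i (insert p D) = addable l i D - {p}"
  proof (intro set_eqI, clarify)
    fix c d
    have "c = 1 \<or> (c - 1, d) \<noteq> p" if "residue l (c, d) = int i" "1 \<le> c"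
      using n(1)[of "c - 1" d] that rp by auto
    moreover have "d = 1 \<or> (c, d - 1) \<noteq> p" if "residue l (c, d) = int i" "1 \<le> d"
      using n(2)[of c "d - 1"] that rp by auto
    ultimately show "(c, d) \<in> addable l i (insert p D) \<longleftrightarrow> (c, d) \<in> addable l i D - {p}"
      unfolding addable_iff[OF E] addable_iff[OF D] Diff_iff by blast
  qed
  show "removable l i (insert p D) = insert p (removable l i D)"
  proof (intro set_eqI, clarify)
    fix c d
    have "(Suc c, d) \<noteq> p \<and> (c, Suc d) \<noteq> p" if "residue l (c, d) = int i"
      using n[of c d] that rp by auto
    moreover have "(Suc a, b) \<notin> D" "(a, Suc b) \<notin> D"
      using young_diagram_down[OF D, of "Suc a" b a b] young_diagram_down[OF D, of a "Suc b" a b]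
        pD young_diagram_ge_1[OF E, of a b] unfolding ab by auto
    ultimately show "(c, d) \<in> removable l i (insert p D) \<longleftrightarrow> (c, d) \<in> insert p (removable l i D)"
      using rp ab unfolding removable_iff[OF E] insert_iff removable_iff[OF D] by auto
  qed
qed

definition set_sign :: "sign \<Rightarrow> pos \<Rightarrow> sign \<times> pos \<Rightarrow> sign \<times> pos" where
  "set_sign s p x = (if snd x = p then (s, p) else x)"

text \<open>The union of addable and removable \<open>i\<close>-positions is unchanged and the sort
  key ignores signs, so the letters keep their order and one sign flips. The second form serves
  \<open>e_hat\<close>, where the smaller diagram is the result.\<close>

lemma ladder_signature_insert:
  assumes "2 \<le> l" "young_diagram D" "p \<in> addable l i D"
  shows "ladder_signature l i (insert p D) = map (set_sign Minus p) (ladder_signature l i D)"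
    and "ladder_signature l i D = map (set_sign Plus p) (ladder_signature l i (insert p D))"
proof -
  note AR = addable_removable_insert[OF assms]
  have un: "addable l i (insert p D) \<union> removable l i (insert p D) = addable l i D \<union> removable l i D"
    using AR assms(3) by auto
  let ?sgn = "\<lambda>E (n, q). (if q \<in> addable l i E then Plus else Minus, q)"
  define xs where
    "xs = sorted_list_of_set {(ladder_index l q, q) | q. q \<in> addable l i D \<union> removable l i D}"
  have sig: "ladder_signature l i D = map (?sgn D) xs"
    "ladder_signature l i (insert p D) = map (?sgn (insert p D)) xs"
    unfolding ladder_signature_def un xs_def by (rule refl)+
  have "?sgn (insert p D) x = set_sign Minus p (?sgn D x)" for x :: "nat \<times> pos"
    unfolding AR(1) by (cases x) (simp add: set_sign_def)
  then show "ladder_signature l i (insert p D) = map (set_sign Minus p) (ladder_signature l i D)"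
    unfolding sig by simp
  have "?sgn D x = set_sign Plus p (?sgn (insert p D) x)" for x :: "nat \<times> pos"
    unfolding AR(1) using assms(3) by (cases x) (simp add: set_sign_def)
  then show "ladder_signature l i D = map (set_sign Plus p) (ladder_signature l i (insert p D))"
    unfolding sig by simp
qed

section \<open>Reduction of signatures after a sign change\<close>

text \<open>As positions are distinct and \<open>p\<close> survives in \<open>w'\<close>, the
  cancelled pair does not involve \<open>p\<close>, so the same pair still cancels after the sign
  change.\<close>

lemma cancel_step_set_sign:
  assumes "cancel_step w w'" "distinct (map snd w)" "p \<in> snd ` set w'"
  shows "cancel_step (map (set_sign s p) w) (map (set_sign s p) w')"
  using assms
proof (induction rule: cancel_step.induct)
  case (1 xs q r ys)
  then have "q \<noteq> p" "r \<noteq> p" by auto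
  then show ?case by (simp add: set_sign_def cancel_step.intros)
qed

lemma cancel_step_sublist:
  assumes "cancel_step w w'"
  shows "set w' \<subseteq> set w" "distinct (map snd w) \<Longrightarrow> distinct (map snd w')"
  using assms by (induction rule: cancel_step.induct) auto

lemma distinct_reduce: "distinct (map snd w) \<Longrightarrow> distinct (map snd (reduce w))"
  using cancel_steps_reduce[of w]
  by (induction rule: rtranclp_induct) (auto dest: cancel_step_sublist(2))

lemma reduce_map_set_sign:
  assumes "cancel_step\<^sup>*\<^sup>* w v" "distinct (map snd w)" "p \<in> snd ` set v"
  shows "reduce (map (set_sign s p) w) = reduce (map (set_sign s p) v)"
  using assms
proof (induction rule: converse_rtranclp_induct)
  case (step y z)
  \<comment> \<open>Cancellation only deletes letters, so a position present at the end is present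
    at every intermediate word.\<close>
  have "set v \<subseteq> set z"
    using step.hyps(2)
    by (induction rule: converse_rtranclp_induct) (auto dest: cancel_step_sublist(1))
  then have "p \<in> snd ` set z" using step.prems(2) by blast
  then have "reduce (map (set_sign s p) y) = reduce (map (set_sign s p) z)"
    by (intro reduce_cancel_step cancel_step_set_sign step.hyps(1) step.prems(1))
  also have "\<dots> = reduce (map (set_sign s p) v)"
    by (rule step.IH[OF cancel_step_sublist(2)[OF step.hyps(1) step.prems(1)] step.prems(2)])
  finally show ?case .
qed simp

text \<open>A new leading \<open>Minus\<close> either cancels the first \<open>Plus\<close> or
  precedes a word without any \<open>Plus\<close>; a new leading \<open>Plus\<close> never
  cancels.\<close>

lemma reduce_split:
  "\<exists>u v. reduce w = u @ v \<and> (\<forall>x\<in>set u. fst x = Plus) \<and> (\<forall>x\<in>set v. fst x = Minus)"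
proof (induction w)
  case (Cons x w)
  then obtain u v where uv: "reduce w = u @ v" "\<forall>x\<in>set u. fst x = Plus" "\<forall>x\<in>set v. fst x = Minus"
    by blast
  show ?case
  proof (cases "fst x")
    case Plus
    then have "reduce (x # w) = (x # u) @ v" using uv(1) by (auto split: list.splits)
    with uv Plus show ?thesis by (metis set_ConsD)
  next
    case Minus
    show ?thesis
    proof (cases u)
      case Nil
      then have "reduce (x # w) = [] @ (x # v)" using uv by (auto split: list.splits)
      with uv Minus show ?thesis by (metis empty_iff empty_set set_ConsD)
    next
      case (Cons y u')
      then have "reduce (x # w) = u' @ v" using uv Minus by simp
      with uv Cons show ?thesis by (metis list.set_intros(2))
    qed
  qed
qed simp

lemma reduce_Plus_Minus:
  assumes "\<forall>x\<in>set u. fst x = Plus" "\<forall>x\<in>set v. fst x = Minus"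
  shows "reduce (u @ v) = u @ v"
proof -
  have "reduce v = v" using assms(2) by (induction v) (auto split: list.splits)
  then show ?thesis using assms(1) by (induction u) (auto split: list.splits)
qed

text \<open>By the shape of reduced words, the two lists of remaining positions determine the whole
  reduced signature.\<close>

lemma reduced_signature_remaining:
  "reduced_signature l i D =
     map (Pair Plus) (remaining Plus l i D) @ map (Pair Minus) (remaining Minus l i D)"
proof -
  obtain u v where uv: "reduced_signature l i D = u @ v"
    and s: "\<forall>x\<in>set u. fst x = Plus" "\<forall>x\<in>set v. fst x = Minus"
    using reduce_split unfolding reduced_signature_def by blast
  have "map (Pair Plus) (map snd u) = u" "map (Pair Minus) (map snd v) = v"
    using s by (auto intro!: map_idI simp: prod_eq_iff)
  moreover have "filter (\<lambda>x. fst x = Plus) u = u" "filter (\<lambda>x. fst x = Plus) v = []"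
    "filter (\<lambda>x. fst x = Minus) u = []" "filter (\<lambda>x. fst x = Minus) v = v"
    using s by (auto simp: filter_id_conv filter_empty_conv)
  ultimately show ?thesis unfolding remaining_def uv by simp
qed

lemma remaining_eqI:
  assumes "reduced_signature l i D = map (Pair Plus) ps @ map (Pair Minus) ms"
  shows "remaining Plus l i D = ps" "remaining Minus l i D = ms"
  unfolding remaining_def assms by (simp_all add: filter_map comp_def)

lemma distinct_remaining_append:
  assumes "young_diagram D"
  shows "distinct (remaining Plus l i D @ remaining Minus l i D)"
proof -
  have "distinct (map snd (reduced_signature l i D))"
    unfolding reduced_signature_def by (rule distinct_reduce[OF ladder_signature_props(2)[OF assms]])
  then show ?thesis unfolding reduced_signature_remaining by (simp add: comp_def)
qed

text \<open>A common form for both operators: \<open>p\<close> sits at the boundary between the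
  signs, as the last \<open>Plus\<close> if \<open>s = Minus\<close> and as the first
  \<open>Minus\<close> if \<open>s = Plus\<close>. Flipping it only moves the boundary, so the word
  keeps its reduced shape and nothing new cancels.\<close>

lemma remaining_set_sign:
  assumes D: "young_diagram D"
    and "remaining Plus l i D @ remaining Minus l i D = ps @ p # ms"
    and "length (remaining Plus l i D) = length ps + (if s = Minus then 1 else 0)"
    and E: "ladder_signature l i E = map (set_sign s p) (ladder_signature l i D)"
  shows "remaining Plus l i E = ps @ (if s = Plus then [p] else [])"
    and "remaining Minus l i E = (if s = Minus then [p] else []) @ ms"
proof -
  have dist: "p \<notin> set ps" "p \<notin> set ms"
    using distinct_remaining_append[OF D, of l i] unfolding assms(2) by auto
  \<comment> \<open>\<open>P\<close> is what follows \<open>ps\<close> among the remaining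
    \<open>Plus\<close> positions: the single entry \<open>p\<close> if \<open>s = Minus\<close>,
    and empty if \<open>s = Plus\<close>.\<close>
  obtain P M where PM: "remaining Plus l i D = ps @ P" "remaining Minus l i D = M" "P @ M = p # ms"
    "length P = (if s = Minus then 1 else 0)"
    using assms(2,3) by (auto simp: append_eq_append_conv2 split: if_splits)
  have red: "reduced_signature l i D = map (Pair Plus) (ps @ P) @ map (Pair Minus) M"
    unfolding reduced_signature_remaining PM ..
  have "snd ` set (reduced_signature l i D) = set ps \<union> set (P @ M)"
    unfolding red by (auto simp: image_Un image_image)
  then have "p \<in> snd ` set (reduced_signature l i D)" unfolding PM(3) by simp
  then have "reduced_signature l i E = reduce (map (set_sign s p) (reduced_signature l i D))"
    unfolding reduced_signature_def E
    by (rule reduce_map_set_sign[OF cancel_steps_reduce ladder_signature_props(2)[OF D]])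
  also have "map (set_sign s p) (reduced_signature l i D) =
      map (Pair Plus) (ps @ (if s = Plus then [p] else [])) @
      map (Pair Minus) ((if s = Minus then [p] else []) @ ms)"
    using PM(3,4) dist unfolding red
    by (cases s; cases P) (auto simp: set_sign_def)
  also have "reduce \<dots> = \<dots>" by (rule reduce_Plus_Minus) auto
  finally show "remaining Plus l i E = ps @ (if s = Plus then [p] else [])"
    "remaining Minus l i E = (if s = Minus then [p] else []) @ ms"
    by (rule remaining_eqI)+
qed

section \<open>String lengths along the crystal operators\<close>

lemma f_hat_step:
  assumes "2 \<le> l" and D: "young_diagram D" and ne: "phi_hat l i D \<noteq> 0"
  shows "\<exists>E. f_hat l i D = Some E \<and> young_diagram E \<and>
    phi_hat l i E = phi_hat l i D - 1 \<and> eps_hat l i E = Suc (eps_hat l i D)"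
proof -
  define p where "p = last (remaining Plus l i D)"
  have ne': "remaining Plus l i D \<noteq> []" using ne by (simp add: phi_hat_def)
  have f: "f_hat l i D = Some (insert p D)" using ne' by (simp add: f_hat_def p_def)
  have p: "p \<in> addable l i D" using set_remaining(1)[OF D, of l i] ne' by (auto simp: p_def)
  have sig: "ladder_signature l i (insert p D) = map (set_sign Minus p) (ladder_signature l i D)"
    by (rule ladder_signature_insert(1)[OF assms(1) D p])
  have eq: "remaining Plus l i D @ remaining Minus l i D =
      butlast (remaining Plus l i D) @ p # remaining Minus l i D"
    using ne' by (metis append.assoc append_Cons append_Nil append_butlast_last_id p_def)
  have len: "length (remaining Plus l i D) =
      length (butlast (remaining Plus l i D)) + (if Minus = Minus then 1 else 0)"
    using ne' by simp
  note R = remaining_set_sign[OF D eq len sig]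
  show ?thesis
    using f young_diagram_f_hat[OF D f] R by (simp add: phi_hat_def eps_hat_def)
qed

lemma e_hat_step:
  assumes "2 \<le> l" and D: "young_diagram D" and ne: "eps_hat l i D \<noteq> 0"
  shows "\<exists>E. e_hat l i D = Some E \<and> young_diagram E \<and>
    eps_hat l i E = eps_hat l i D - 1 \<and> phi_hat l i E = Suc (phi_hat l i D)"
proof -
  define p where "p = hd (remaining Minus l i D)"
  have ne': "remaining Minus l i D \<noteq> []" using ne by (simp add: eps_hat_def)
  have e: "e_hat l i D = Some (D - {p})" using ne' by (simp add: e_hat_def p_def)
  note E = young_diagram_e_hat[OF D e]
  have "p \<in> removable l i D" using set_remaining(2)[OF D, of l i] ne' by (auto simp: p_def)
  \<comment> \<open>The diagram is viewed as \<open>D - {p}\<close> with an addable box inserted, so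
    that the insertion lemma can be read backwards.\<close>
  then have ins: "insert p (D - {p}) = D" and p: "p \<in> addable l i (D - {p})"
    using D by (auto simp: removable_def addable_def insert_absorb)
  have sig: "ladder_signature l i (D - {p}) = map (set_sign Plus p) (ladder_signature l i D)"
    using ladder_signature_insert(2)[OF assms(1) E p] unfolding ins .
  have eq: "remaining Plus l i D @ remaining Minus l i D =
      remaining Plus l i D @ p # tl (remaining Minus l i D)"
    using ne' by (simp add: p_def)
  have len: "length (remaining Plus l i D) =
      length (remaining Plus l i D) + (if Plus = Minus then 1 else 0)"
    by simp
  note R = remaining_set_sign[OF D eq len sig]
  show ?thesis
    using e E R by (simp add: phi_hat_def eps_hat_def)
qed

lemma crystal_power_Suc:
  "crystal_power g (Suc k) D = Option.bind (crystal_power g k D) g"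
  by (simp add: crystal_power_def)

text \<open>The bound on \<open>k\<close> keeps a remaining \<open>Plus\<close> available before
  each step, so the iteration never reaches \<open>None\<close>.\<close>

lemma crystal_power_f_hat:
  assumes "2 \<le> l" "young_diagram D" "k \<le> phi_hat l i D"
  shows "\<exists>E. crystal_power (f_hat l i) k D = Some E \<and> young_diagram E \<and>
    phi_hat l i E = phi_hat l i D - k \<and> eps_hat l i E = eps_hat l i D + k"
  using assms(3)
proof (induction k)
  case 0
  then show ?case using assms(2) by (simp add: crystal_power_def)
next
  case (Suc k)
  then obtain E where E: "crystal_power (f_hat l i) k D = Some E" "young_diagram E"
    "phi_hat l i E = phi_hat l i D - k" "eps_hat l i E = eps_hat l i D + k" by auto
  with Suc.prems f_hat_step[OF assms(1) E(2), of i] show ?case by (auto simp: crystal_power_Suc)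
qed

lemma crystal_power_e_hat:
  assumes "2 \<le> l" "young_diagram D" "k \<le> eps_hat l i D"
  shows "\<exists>E. crystal_power (e_hat l i) k D = Some E \<and> young_diagram E \<and>
    eps_hat l i E = eps_hat l i D - k \<and> phi_hat l i E = phi_hat l i D + k"
  using assms(3)
proof (induction k)
  case 0
  then show ?case using assms(2) by (simp add: crystal_power_def)
next
  case (Suc k)
  then obtain E where E: "crystal_power (e_hat l i) k D = Some E" "young_diagram E"
    "eps_hat l i E = eps_hat l i D - k" "phi_hat l i E = phi_hat l i D + k" by auto
  with Suc.prems e_hat_step[OF assms(1) E(2), of i] show ?case by (auto simp: crystal_power_Suc)
qed

text \<open>Two entries of the distinct list of remaining \<open>Plus\<close> positions are
  different addable \<open>i\<close>-positions, and a remaining \<open>Minus\<close> gives a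
  removable \<open>i\<close>-box; uniqueness of the addable position is then contradicted.\<close>

lemma not_JM_partition:
  assumes "2 \<le> l" and D: "young_diagram D" and "2 \<le> phi_hat l i D" "1 \<le> eps_hat l i D"
  shows "\<not> JM_partition l D"
proof
  assume JM: "JM_partition l D"
  let ?P = "remaining Plus l i D" and ?M = "remaining Minus l i D"
  have len: "2 \<le> length ?P" "?M \<noteq> []" using assms(3,4) by (auto simp: phi_hat_def eps_hat_def)
  have "?P ! 0 \<in> set ?P" "?P ! 1 \<in> set ?P" "hd ?M \<in> set ?M"
    using len by (auto intro!: nth_mem)
  then have "?P ! 0 \<in> addable l i D" "?P ! 1 \<in> addable l i D" "hd ?M \<in> removable l i D"
    using set_remaining[OF D, of l i] by blast+
  then have "?P ! 0 = ?P ! 1" using JM_partition_addable_unique[OF assms(1) D JM] by blast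
  moreover have "distinct ?P" using distinct_remaining_append[OF D] by simp
  ultimately show False using len(1) nth_eq_iff_index_eq[of ?P 0 1] by force
qed

theorem theorem3p7p3p2:
  fixes l i :: nat and lam :: "pos set"
  assumes "l \<ge> 3"
    and "young_diagram lam"
    and "JM_partition l lam"
    and "i < l"
  shows "(\<forall>k. 0 < k \<and> k < phi_hat l i lam - 1 \<longrightarrow>
            (\<exists>\<mu>. crystal_power (f_hat l i) k lam = Some \<mu> \<and> \<not> JM_partition l \<mu>)) \<and>
         (\<forall>k. 1 < k \<and> k < eps_hat l i lam \<longrightarrow>
            (\<exists>\<mu>. crystal_power (e_hat l i) k lam = Some \<mu> \<and> \<not> JM_partition l \<mu>))"
proof (intro conjI allI impI)
  have l: "2 \<le> l" using assms(1) by simp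
  fix k
  \<comment> \<open>After \<open>k\<close> steps at least two \<open>Plus\<close> remain because
    \<open>k < phi_hat l i lam - 1\<close>, and at least \<open>k \<ge> 1\<close>
    \<open>Minus\<close> remain.\<close>
  show "\<exists>\<mu>. crystal_power (f_hat l i) k lam = Some \<mu> \<and> \<not> JM_partition l \<mu>"
    if "0 < k \<and> k < phi_hat l i lam - 1"
    using crystal_power_f_hat[OF l assms(2), of k i] not_JM_partition[OF l, of _ i] that by fastforce
  \<comment> \<open>Dually, at least one \<open>Minus\<close> is left because
    \<open>k < eps_hat l i lam\<close>, and the \<open>k \<ge> 2\<close> steps have produced at
    least two remaining \<open>Plus\<close>.\<close>
  show "\<exists>\<mu>. crystal_power (e_hat l i) k lam = Some \<mu> \<and> \<not> JM_partition l \<mu>"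
    if "1 < k \<and> k < eps_hat l i lam"
    using crystal_power_e_hat[OF l assms(2), of k i] not_JM_partition[OF l, of _ i] that by fastforce
qed

end
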